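(* Let $\mathbf n=(n_k)_{k\ge1}$ be a strictly increasing sequence of positive integers and let $\mathcal B=(e_n)$ be a basis of a Banach space $X$ with biorthogonal functionals $(e_n^* )$. For every $m\in\mathbb N$: (i) $\widehat{\mathbf L}^{\mathbf n}_m\le 1+2\kappa m$, where $\kappa=\sup_{j,k}\|e_j\|\,\|e_k^*\|$; (ii) $\widehat{\mathbf L}^{\mathbf n}_m\le g^c_m+\tilde g_m\, sc^{\mathbf n}_m$; (iii) $\widehat{\mathbf L}^{\mathbf n}_m\le g^c_{m-1}\,\omega^{\mathbf n}_m$.
   Context: $X$ is a separable infinite-dimensional Banach space over $\mathbb F=\mathbb R$ or $\mathbb C$; $\mathbb N=\{1,2,\dots\}$. A basis of $X$ is a sequence $\mathcal B=(e_n)_{n\ge1}\subset X$ whose linear span is norm-dense and for which there is a sequence $(e_n^* )_{n\ge1}\subset X^*$ with $e_j^*(e_k)=\delta_{j,k}$ and $0<\inf_n\{\|e_n\|,\|e_n^*\|\}\le\sup_n\{\|e_n\|,\|e_n^*\|\}<\infty$ (then $e_n^*(x)\to0$ for every $x$). For a finite set $A\subset\mathbb N$, $P_A(x)=\sum_{n\in A}e_n^*(x)e_n$. For $x\in X$ and an integer $m\ge0$, a greedy set of $x$ of order $m$ is a set $A\subset\mathbb N$ with $|A|=m$ and $\min_{n\in A}|e_n^*(x)|\ge\max_{n\notin A}|e_n^*(x)|$ (the empty set if $m=0$); $G_m(x)$ denotes $P_A(x)$ for such an $A$ (not necessarily unique). The sequence $\mathbf n$ is identified with its set of terms; $P^{\mathbf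 n}_0(x)=0$, $P^{\mathbf n}_k(x)=\sum_{i=1}^k e_{n_i}^*(x)e_{n_i}$, $\widehat\sigma^{\mathbf n}_m(x)=\min_{0\le k\le m}\|x-P^{\mathbf n}_k(x)\|$. $\gamma_m(x)=\sup_{G_m(x)}\|x-G_m(x)\|$ (over all choices of $G_m(x)$), and $\widehat{\mathbf L}^{\mathbf n}_m$ is the smallest constant such that $\gamma_m(x)\le\widehat{\mathbf L}^{\mathbf n}_m\,\widehat\sigma^{\mathbf n}_m(x)$ for all $x\in X$. A greedy operator $\mathcal G_m:X\to X$ of order $m$ maps each $x$ to some greedy sum $P_A(x)$, $A$ a greedy set of $x$ of order $m$ (so $\mathcal G_0=0$). With $\operatorname{supp}(x)=\{n:e_n^*(x)\ne0\}$, write $\mathcal G_k<\mathcal G_j$ if $k<j$ and $\operatorname{supp}(\mathcal G_k(x))\subset\operatorname{supp}(\mathcal G_j(x))$ for all $x\in X$. For a (possibly nonlinear) map $T:X\to X$, $\|T\|=\sup_{x\ne0}\|T(x)\|/\|x\|$. Define $$g^c_m=\sup\{\|I-\mathcal G_k\|:0\le k\le m\},\qquad \tilde g_m=\sup\{\|\mathcal G_k-\mathcal G_j\|:0\le k<j\le m,\ \mathcal G_k<\mathcal G_j\},$$ the suprema also being over all greedy operators of the indicated orders. A sign is a sequence $\varepsilon=(\varepsilon_n)_n$ of scalars of modulus $1$; $1_{\varepsilon A}=\sum_{n\in A}\varepsilon_ne_n$; $\|x\|_\infty=\max_n|e_n^*(x)|$. $A<B$ means $a<b$ for all $a\in A,b\in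 B$ (vacuous if one is empty); $A\le N$ means $a\le N$ for all $a\in A$. Define $$sc^{\mathbf n}_m=\sup\frac{\|1_{\varepsilon A}\|}{\|1_{\delta B}\|}$$ over all signs $\varepsilon,\delta$ and finite sets $A\subset\mathbf n$, $B\subset\mathbb N$ with $|A|\le|B|\le m$, $A\le n_m$, $A<B\cap\mathbf n$; and $$\omega^{\mathbf n}_m=\sup\frac{\|x+1_{\varepsilon A}\|}{\|x+1_{\delta B}\|}$$ over all signs $\varepsilon,\delta$, all $x\in X$ with $\|x\|_\infty\le1$, and all finite sets $A\subset\mathbf n$, $B\subset\mathbb N$ with $|A|\le|B|\le m$, $A\le n_m$, $B\cap\operatorname{supp}(x)=\emptyset$ and $A<(\operatorname{supp}(x)\cup B)\cap\mathbf n$. (Ratios $0/0$ are disregarded.) *)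

theory Defs
  imports "HOL-Analysis.Analysis"
begin

text \<open>
  The scalar field is a type \<open>'f\<close> of class \<open>real_normed_field\<close> (with multiplicative norm). By the
  Gelfand--Mazur theorem such a field is isometrically isomorphic to the reals or the complex
  numbers, so this is exactly the usual choice of scalars; both \<open>real\<close> and \<open>complex\<close> are instances.
  The type class \<open>banach\<close> only provides real scalars, hence the explicit scalar multiplication
  \<open>smul\<close>, which is required to extend the real one.
\<close>

locale separable_banach_space = vector_space smul
  for smul :: "'f::real_normed_field \<Rightarrow> 'a::banach \<Rightarrow> 'a" +
  assumes norm_scale: "norm (smul c x) = norm c * norm x"
    and scale_of_real: "smul (of_real r) x = r *\<^sub>R x"
    and separable: "separable_space (euclidean :: 'a topology)"
    and infinite_dimensional: "\<nexists>S. finite S \<and> span S = UNIV"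

text \<open>
  All sequences are indexed by the positive integers \<open>{1..}\<close>; values at index \<open>0\<close> are irrelevant.
  Throughout, \<open>es n\<close> is the biorthogonal functional of \<open>e n\<close>. The basis is not assumed to be
  total: \<open>es n x = 0\<close> for all \<open>n\<close> need not imply \<open>x = 0\<close>.
\<close>

definition basis_of ::
  "('f::real_normed_field \<Rightarrow> 'a::banach \<Rightarrow> 'a) \<Rightarrow> (nat \<Rightarrow> 'a) \<Rightarrow> (nat \<Rightarrow> 'a \<Rightarrow> 'f) \<Rightarrow> bool" where
  "basis_of smul e es \<longleftrightarrow>
     closure (module.span smul (e ` {1..})) = UNIV \<and>
     (\<forall>n\<ge>1. bounded_linear (es n) \<and> (\<forall>c x. es n (smul c x) = c * es n x)) \<and>
     (\<forall>j\<ge>1. \<forall>k\<ge>1. es j (e k) = (if j = k then 1 else 0)) \<and>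
     (\<exists>a>0. \<forall>n\<ge>1. a \<le> norm (e n) \<and> a \<le> onorm (es n)) \<and>
     (\<exists>b. \<forall>n\<ge>1. norm (e n) \<le> b \<and> onorm (es n) \<le> b)"

definition coord_proj ::
  "('f::real_normed_field \<Rightarrow> 'a::banach \<Rightarrow> 'a) \<Rightarrow> (nat \<Rightarrow> 'a) \<Rightarrow> (nat \<Rightarrow> 'a \<Rightarrow> 'f) \<Rightarrow> nat set \<Rightarrow> 'a \<Rightarrow> 'a"
  where "coord_proj smul e es A x = (\<Sum>n\<in>A. smul (es n x) (e n))"

definition supp :: "(nat \<Rightarrow> 'a::banach \<Rightarrow> 'f::real_normed_field) \<Rightarrow> 'a \<Rightarrow> nat set" where
  "supp es x = {n. n \<ge> 1 \<and> es n x \<noteq> 0}"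

definition greedy_set ::
  "(nat \<Rightarrow> 'a::banach \<Rightarrow> 'f::real_normed_field) \<Rightarrow> nat \<Rightarrow> 'a \<Rightarrow> nat set \<Rightarrow> bool" where
  "greedy_set es m x A \<longleftrightarrow>
     finite A \<and> A \<subseteq> {1..} \<and> card A = m \<and> (\<forall>a\<in>A. \<forall>b\<in>{1..} - A. norm (es b x) \<le> norm (es a x))"

text \<open>
  Suprema and ratios are taken in \<open>ennreal\<close>, so no boundedness has to be presupposed. There
  \<open>0 / 0 = 0\<close>, so degenerate ratios do not contribute to a supremum, while \<open>c / 0 = \<infinity>\<close> for \<open>c > 0\<close>.
\<close>

definition kappa :: "(nat \<Rightarrow> 'a::banach) \<Rightarrow> (nat \<Rightarrow> 'a \<Rightarrow> 'f::real_normed_field) \<Rightarrow> ennreal" where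
  "kappa e es = (SUP j\<in>{1..}. SUP k\<in>{1..}. ennreal (norm (e j) * onorm (es k)))"

definition partial_sum ::
  "('f::real_normed_field \<Rightarrow> 'a::banach \<Rightarrow> 'a) \<Rightarrow> (nat \<Rightarrow> 'a) \<Rightarrow> (nat \<Rightarrow> 'a \<Rightarrow> 'f) \<Rightarrow> (nat \<Rightarrow> nat)
    \<Rightarrow> nat \<Rightarrow> 'a \<Rightarrow> 'a"
  where "partial_sum smul e es nn k x = (\<Sum>i=1..k. smul (es (nn i) x) (e (nn i)))"

definition sigma_hat ::
  "('f::real_normed_field \<Rightarrow> 'a::banach \<Rightarrow> 'a) \<Rightarrow> (nat \<Rightarrow> 'a) \<Rightarrow> (nat \<Rightarrow> 'a \<Rightarrow> 'f) \<Rightarrow> (nat \<Rightarrow> nat)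
    \<Rightarrow> nat \<Rightarrow> 'a \<Rightarrow> real"
  where "sigma_hat smul e es nn m x = (MIN k\<in>{0..m}. norm (x - partial_sum smul e es nn k x))"

definition gamma_greedy ::
  "('f::real_normed_field \<Rightarrow> 'a::banach \<Rightarrow> 'a) \<Rightarrow> (nat \<Rightarrow> 'a) \<Rightarrow> (nat \<Rightarrow> 'a \<Rightarrow> 'f) \<Rightarrow> nat \<Rightarrow> 'a \<Rightarrow> ennreal"
  where "gamma_greedy smul e es m x =
    (SUP A\<in>{A. greedy_set es m x A}. ennreal (norm (x - coord_proj smul e es A x)))"

definition L_hat ::
  "('f::real_normed_field \<Rightarrow> 'a::banach \<Rightarrow> 'a) \<Rightarrow> (nat \<Rightarrow> 'a) \<Rightarrow> (nat \<Rightarrow> 'a \<Rightarrow> 'f) \<Rightarrow> (nat \<Rightarrow> nat)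
    \<Rightarrow> nat \<Rightarrow> ennreal"
  where "L_hat smul e es nn m =
    Inf {C. \<forall>x. gamma_greedy smul e es m x \<le> C * ennreal (sigma_hat smul e es nn m x)}"

definition greedy_operator ::
  "('f::real_normed_field \<Rightarrow> 'a::banach \<Rightarrow> 'a) \<Rightarrow> (nat \<Rightarrow> 'a) \<Rightarrow> (nat \<Rightarrow> 'a \<Rightarrow> 'f) \<Rightarrow> nat \<Rightarrow> ('a \<Rightarrow> 'a) \<Rightarrow> bool"
  where "greedy_operator smul e es m G \<longleftrightarrow>
    (\<forall>x. \<exists>A. greedy_set es m x A \<and> G x = coord_proj smul e es A x)"

text \<open>The norm of a possibly nonlinear map (\<open>onorm\<close> is only meaningful for bounded ratios).\<close>

definition op_norm :: "('a::banach \<Rightarrow> 'a) \<Rightarrow> ennreal" where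
  "op_norm T = (SUP x\<in>{x. x \<noteq> 0}. ennreal (norm (T x)) / ennreal (norm x))"

definition g_c ::
  "('f::real_normed_field \<Rightarrow> 'a::banach \<Rightarrow> 'a) \<Rightarrow> (nat \<Rightarrow> 'a) \<Rightarrow> (nat \<Rightarrow> 'a \<Rightarrow> 'f) \<Rightarrow> nat \<Rightarrow> ennreal"
  where "g_c smul e es m =
    Sup {op_norm (\<lambda>x. x - G x) | G k. k \<le> m \<and> greedy_operator smul e es k G}"

definition g_tilde ::
  "('f::real_normed_field \<Rightarrow> 'a::banach \<Rightarrow> 'a) \<Rightarrow> (nat \<Rightarrow> 'a) \<Rightarrow> (nat \<Rightarrow> 'a \<Rightarrow> 'f) \<Rightarrow> nat \<Rightarrow> ennreal"
  where "g_tilde smul e es m =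
    Sup {op_norm (\<lambda>x. G x - H x) | G H k j. k < j \<and> j \<le> m \<and>
           greedy_operator smul e es k G \<and> greedy_operator smul e es j H \<and>
           (\<forall>x. supp es (G x) \<subseteq> supp es (H x))}"

definition is_sign :: "(nat \<Rightarrow> 'f::real_normed_field) \<Rightarrow> bool" where
  "is_sign \<epsilon> \<longleftrightarrow> (\<forall>n\<ge>1. norm (\<epsilon> n) = 1)"

definition signed_indicator ::
  "('f::real_normed_field \<Rightarrow> 'a::banach \<Rightarrow> 'a) \<Rightarrow> (nat \<Rightarrow> 'a) \<Rightarrow> (nat \<Rightarrow> 'f) \<Rightarrow> nat set \<Rightarrow> 'a"
  where "signed_indicator smul e \<epsilon> A = (\<Sum>n\<in>A. smul (\<epsilon> n) (e n))"

definition sup_norm :: "(nat \<Rightarrow> 'a::banach \<Rightarrow> 'f::real_normed_field) \<Rightarrow> 'a \<Rightarrow> ennreal" where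
  "sup_norm es x = (SUP n\<in>{1..}. ennreal (norm (es n x)))"

definition set_less :: "nat set \<Rightarrow> nat set \<Rightarrow> bool" where
  "set_less A B \<longleftrightarrow> (\<forall>a\<in>A. \<forall>b\<in>B. a < b)"

definition sc ::
  "('f::real_normed_field \<Rightarrow> 'a::banach \<Rightarrow> 'a) \<Rightarrow> (nat \<Rightarrow> 'a) \<Rightarrow> (nat \<Rightarrow> nat) \<Rightarrow> nat \<Rightarrow> ennreal"
  where "sc smul e nn m =
    Sup {ennreal (norm (signed_indicator smul e \<epsilon> A)) / ennreal (norm (signed_indicator smul e \<delta> B))
         | \<epsilon> \<delta> A B. is_sign \<epsilon> \<and> is_sign \<delta> \<and>
             finite A \<and> A \<subseteq> nn ` {1..} \<and> finite B \<and> B \<subseteq> {1..} \<and>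
             card A \<le> card B \<and> card B \<le> m \<and> (\<forall>a\<in>A. a \<le> nn m) \<and>
             set_less A (B \<inter> nn ` {1..})}"

definition omega ::
  "('f::real_normed_field \<Rightarrow> 'a::banach \<Rightarrow> 'a) \<Rightarrow> (nat \<Rightarrow> 'a) \<Rightarrow> (nat \<Rightarrow> 'a \<Rightarrow> 'f) \<Rightarrow> (nat \<Rightarrow> nat)
    \<Rightarrow> nat \<Rightarrow> ennreal"
  where "omega smul e es nn m =
    Sup {ennreal (norm (x + signed_indicator smul e \<epsilon> A))
           / ennreal (norm (x + signed_indicator smul e \<delta> B))
         | x \<epsilon> \<delta> A B. is_sign \<epsilon> \<and> is_sign \<delta> \<and> sup_norm es x \<le> 1 \<and>
             finite A \<and> A \<subseteq> nn ` {1..} \<and> finite B \<and> B \<subseteq> {1..} \<and>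
             card A \<le> card B \<and> card B \<le> m \<and> (\<forall>a\<in>A. a \<le> nn m) \<and>
             B \<inter> supp es x = {} \<and>
             set_less A ((supp es x \<union> B) \<inter> nn ` {1..})}"

end

theory Submission
  imports Defs
begin

text \<open>
  Fix \<open>x\<close>, a greedy set \<open>A\<close> of \<open>x\<close> of order \<open>m\<close>, and \<open>k \<le> m\<close>. With \<open>D = {nn 1, ..., nn k}\<close> put
  \<open>y = x - P D x\<close>, \<open>B = A - D\<close> and \<open>H = D - A\<close>. Everything rests on the identity
  \<open>x - P A x = (y - P B y) + P H x\<close> (\<open>residual_eq\<close>) together with four observations: \<open>B\<close> is a greedy
  set of \<open>y\<close>; \<open>card H \<le> card B \<le> m\<close>; every coordinate of \<open>x\<close> on \<open>H\<close> is at most the smallest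
  coordinate \<open>t\<close> of \<open>y\<close> on \<open>B\<close>, in modulus; and \<open>H\<close> lies in the initial segment \<open>D\<close>, hence to the
  left of all terms of the subsequence outside \<open>D\<close>. A bound of \<open>x - P A x\<close> by \<open>C\<close> times
  \<open>norm y\<close>, for all \<open>x\<close>, \<open>A\<close> and \<open>k\<close>, is a bound of the Lebesgue-type constant by \<open>C\<close>.

  For the bound by \<open>kappa\<close>, each of the at most \<open>2 * m\<close> terms of \<open>P B y\<close> and \<open>P H x\<close> is at most
  \<open>kappa * norm y\<close>; a term of \<open>P H x\<close> is first compared with one of \<open>P B y\<close>.

  The other two bounds exchange \<open>P H x\<close> for a vector on \<open>B\<close>, in three steps. By convexity,
  \<open>P H x\<close> may be replaced by \<open>t\<close> times a signed indicator of \<open>H\<close> (\<open>ex_sign_norm_le\<close>). The constants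
  \<open>sc\<close> and \<open>omega\<close> replace this by \<open>t\<close> times the indicator of \<open>B\<close> with the signs of \<open>y\<close>
  (\<open>norm_ind_le_sc\<close>, \<open>norm_add_scaled_ind_le_omega\<close>). Finally, flattening the coordinates of \<open>y\<close> on
  \<open>B\<close> to the height \<open>t\<close> is an averaging of differences \<open>P B y - P C y\<close> over greedy sets
  \<open>C\<close> properly contained in \<open>B\<close> (\<open>norm_truncation_le\<close>). If \<open>P H x\<close> is estimated alone, the last step
  costs \<open>g_tilde\<close> and \<open>y - P B y\<close> costs \<open>g_c\<close> of order \<open>m\<close>. If \<open>y - P B y\<close> is carried along
  throughout, the last step produces \<open>y - P C y\<close>, which costs \<open>g_c\<close>, and its order is only \<open>m - 1\<close>
  because \<open>C\<close> is strictly smaller than \<open>B\<close>.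
\<close>

section \<open>Two convexity principles\<close>

text \<open>
  Summation by parts, organised as an induction. The weights decrease as \<open>\<rho>\<close> increases, so the element
  \<open>b\<close> where \<open>\<rho>\<close> is largest has the smallest weight. Subtracting \<open>w b\<close> from all weights splits
  off \<open>w b\<close> times the full vector \<open>v + sum f E\<close> and leaves the same problem on \<open>E - {b}\<close> with largest
  weight \<open>W - w b\<close>; lower sets of \<open>E - {b}\<close> are lower sets of \<open>E\<close>. Repeating this writes the left-hand
  vector as a combination, with nonnegative coefficients adding up to \<open>W\<close>, of vectors
  \<open>v + sum f F\<close>, and the longest of these vectors serves. That the weight \<open>W\<close> is attained is what makes
  every \<open>F\<close> nonempty.
\<close>

lemma norm_weighted_sum_le_lower_set:
  fixes f :: "'i \<Rightarrow> 'b::real_normed_vector" and \<rho> :: "'i \<Rightarrow> real"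
  assumes "finite E" "E \<noteq> {}"
    and "\<And>n. n \<in> E \<Longrightarrow> 0 \<le> w n \<and> w n \<le> W"
    and "\<And>a b. a \<in> E \<Longrightarrow> b \<in> E \<Longrightarrow> \<rho> a \<le> \<rho> b \<Longrightarrow> w b \<le> w a"
    and "\<exists>n\<in>E. w n = W"
  shows "\<exists>F\<subseteq>E. F \<noteq> {} \<and> (\<forall>a\<in>F. \<forall>b\<in>E - F. \<rho> a \<le> \<rho> b) \<and>
           norm (W *\<^sub>R v + (\<Sum>n\<in>E. w n *\<^sub>R f n)) \<le> W * norm (v + sum f F)"
  using assms
proof (induction "card E" arbitrary: E w W rule: less_induct)
  case less
  have "Max (\<rho> ` E) \<in> \<rho> ` E" using less.prems(1,2) by (intro Max_in) auto
  moreover have "\<rho> a \<le> Max (\<rho> ` E)" if "a \<in> E" for a using less.prems(1) that by (intro Max_ge) auto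
  ultimately obtain b where b: "b \<in> E" "\<And>a. a \<in> E \<Longrightarrow> \<rho> a \<le> \<rho> b" by auto
  have wb: "0 \<le> w b" "w b \<le> W" "\<And>a. a \<in> E \<Longrightarrow> w b \<le> w a"
    using less.prems(3,4) b by auto
  let ?E = "E - {b}"
  show ?case
  proof (cases "?E = {}")
    case True
    then have E: "E = {b}" using b by auto
    with less.prems(5) have "w b = W" by auto
    then have "W *\<^sub>R v + (\<Sum>n\<in>E. w n *\<^sub>R f n) = W *\<^sub>R (v + sum f E)"
      by (simp add: E scaleR_add_right)
    then show ?thesis using wb less.prems(2) by (intro exI[of _ E]) auto
  next
    case False
    have "\<exists>n\<in>?E. w n - w b = W - w b"
    proof (cases "w b = W")
      case True
      obtain n where "n \<in> ?E" using False by blast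
      then have "w n = W" using True wb(3)[of n] less.prems(3)[of n] by auto
      then show ?thesis using \<open>n \<in> ?E\<close> by auto
    next
      case False
      then show ?thesis using less.prems(5) by auto
    qed
    then have "\<exists>F\<subseteq>?E. F \<noteq> {} \<and> (\<forall>a\<in>F. \<forall>b\<in>?E - F. \<rho> a \<le> \<rho> b) \<and>
        norm ((W - w b) *\<^sub>R v + (\<Sum>n\<in>?E. (w n - w b) *\<^sub>R f n)) \<le> (W - w b) * norm (v + sum f F)"
      using less.prems(1,3,4) wb False b(1)
      by (intro less.hyps card_Diff1_less) auto
    then obtain F where F: "F \<subseteq> ?E" "F \<noteq> {}" "\<forall>a\<in>F. \<forall>b\<in>?E - F. \<rho> a \<le> \<rho> b"
      and le: "norm ((W - w b) *\<^sub>R v + (\<Sum>n\<in>?E. (w n - w b) *\<^sub>R f n)) \<le> (W - w b) * norm (v + sum f F)"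
      by blast
    have F': "\<forall>a\<in>F. \<forall>b\<in>E - F. \<rho> a \<le> \<rho> b" using F b by blast
    have split: "W *\<^sub>R v + (\<Sum>n\<in>E. w n *\<^sub>R f n)
        = w b *\<^sub>R (v + sum f E) + ((W - w b) *\<^sub>R v + (\<Sum>n\<in>?E. (w n - w b) *\<^sub>R f n))"
      using less.prems(1) b(1)
      by (simp add: sum.remove[of E b] scaleR_add_right scaleR_diff_left sum_subtractf scaleR_sum_right)
    have bound: "norm (W *\<^sub>R v + (\<Sum>n\<in>E. w n *\<^sub>R f n))
        \<le> w b * norm (v + sum f E) + (W - w b) * norm (v + sum f F)"
      unfolding split using wb le by (intro norm_triangle_le) auto
    show ?thesis
    proof (cases "norm (v + sum f E) \<le> norm (v + sum f F)")
      case True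
      then have "w b * norm (v + sum f E) \<le> w b * norm (v + sum f F)"
        using wb by (intro mult_left_mono)
      with bound have "norm (W *\<^sub>R v + (\<Sum>n\<in>E. w n *\<^sub>R f n)) \<le> W * norm (v + sum f F)"
        by (simp add: algebra_simps)
      then show ?thesis using F F' by (intro exI[of _ F]) auto
    next
      case False
      then have "(W - w b) * norm (v + sum f F) \<le> (W - w b) * norm (v + sum f E)"
        using wb by (intro mult_left_mono) auto
      with bound have "norm (W *\<^sub>R v + (\<Sum>n\<in>E. w n *\<^sub>R f n)) \<le> W * norm (v + sum f E)"
        by (simp add: algebra_simps)
      then show ?thesis using less.prems(2) by (intro exI[of _ E]) auto
    qed
  qed
qed

lemma norm_segment_le_endpoint:
  fixes v g :: "'b::real_normed_vector"
  assumes "\<bar>s\<bar> \<le> t"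
  shows "norm (v + s *\<^sub>R g) \<le> norm (v + t *\<^sub>R g) \<or> norm (v + s *\<^sub>R g) \<le> norm (v - t *\<^sub>R g)"
proof (cases "t = 0")
  case True
  then show ?thesis using assms by simp
next
  case False
  then have t: "t > 0" using assms by linarith
  define a where "a = (t + s) / (2 * t)"
  have a: "0 \<le> a" "a \<le> 1" using assms t by (auto simp: a_def field_simps)
  have as: "a * t - (1 - a) * t = s" using t by (simp add: a_def field_simps)
  have comb: "a *\<^sub>R (v + t *\<^sub>R g) + b *\<^sub>R (v - t *\<^sub>R g) = (a + b) *\<^sub>R v + (a * t - b * t) *\<^sub>R g"
    for a b by (simp add: algebra_simps)
  have "v + s *\<^sub>R g = a *\<^sub>R (v + t *\<^sub>R g) + (1 - a) *\<^sub>R (v - t *\<^sub>R g)"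
    unfolding comb as by simp
  then have "norm (v + s *\<^sub>R g) \<le> a * norm (v + t *\<^sub>R g) + (1 - a) * norm (v - t *\<^sub>R g)"
    using a by (simp only:) (intro norm_triangle_le, simp)
  also have "\<dots> \<le> max (norm (v + t *\<^sub>R g)) (norm (v - t *\<^sub>R g))"
    using a by (intro convex_bound_le) auto
  finally show ?thesis by linarith
qed

section \<open>Coordinates with respect to the basis\<close>

locale banach_basis = separable_banach_space smul
  for smul :: "'f::real_normed_field \<Rightarrow> 'a::banach \<Rightarrow> 'a" +
  fixes e :: "nat \<Rightarrow> 'a" and es :: "nat \<Rightarrow> 'a \<Rightarrow> 'f"
  assumes basis: "basis_of smul e es"
begin

abbreviation P where "P \<equiv> coord_proj smul e es"
abbreviation ind where "ind \<equiv> signed_indicator smul e"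

lemma es_bounded_linear: "n \<ge> 1 \<Longrightarrow> bounded_linear (es n)"
  and es_smul: "n \<ge> 1 \<Longrightarrow> es n (smul c x) = c * es n x"
  and es_e: "j \<ge> 1 \<Longrightarrow> k \<ge> 1 \<Longrightarrow> es j (e k) = (if j = k then 1 else 0)"
  and dense_span: "closure (span (e ` {1..})) = UNIV"
  using basis unfolding basis_of_def by auto

lemmas es_linear = es_bounded_linear[THEN bounded_linear.linear]

lemma es_add: "n \<ge> 1 \<Longrightarrow> es n (x + y) = es n x + es n y"
  and es_diff: "n \<ge> 1 \<Longrightarrow> es n (x - y) = es n x - es n y"
  and es_0: "n \<ge> 1 \<Longrightarrow> es n 0 = 0"
  and es_scaleR: "n \<ge> 1 \<Longrightarrow> es n (r *\<^sub>R x) = r *\<^sub>R es n x"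
  and es_sum: "n \<ge> 1 \<Longrightarrow> es n (\<Sum>i\<in>I. f i) = (\<Sum>i\<in>I. es n (f i))"
  using es_linear[of n] by (auto simp: linear_add linear_diff linear_0 linear_scale linear_sum)

lemma es_bound: "n \<ge> 1 \<Longrightarrow> norm (es n x) \<le> onorm (es n) * norm x"
  by (rule onorm[OF es_bounded_linear])

lemma smul_scaleR: "smul (r *\<^sub>R c) v = r *\<^sub>R smul c v"
  by (metis scaleR_conv_of_real scale_of_real scale_scale)

lemma es_uniformly_bounded: "\<exists>b>0. \<forall>n\<ge>1. \<forall>x. norm (es n x) \<le> b * norm x"
proof -
  obtain b where b: "\<forall>n\<ge>1. norm (e n) \<le> b \<and> onorm (es n) \<le> b"
    using basis unfolding basis_of_def by auto
  have "norm (es n x) \<le> max b 1 * norm x" if "n \<ge> 1" for n x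
  proof -
    have "onorm (es n) * norm x \<le> max b 1 * norm x"
      using b that by (intro mult_right_mono) (auto simp: le_max_iff_disj)
    then show ?thesis using es_bound[OF that, of x] by linarith
  qed
  then show ?thesis by (intro exI[of _ "max b 1"]) auto
qed

lemma es_lincomb:
  assumes "n \<ge> 1" "finite A" "A \<subseteq> {1..}"
  shows "es n (\<Sum>i\<in>A. smul (c i) (e i)) = (if n \<in> A then c n else 0)"
proof -
  have "es n (\<Sum>i\<in>A. smul (c i) (e i)) = (\<Sum>i\<in>A. if n = i then c i else 0)"
    unfolding es_sum[OF assms(1)]
    by (intro sum.cong) (use assms in \<open>auto simp: es_smul es_e subset_iff\<close>)
  then show ?thesis using assms by simp
qed

lemma es_P:
  assumes "n \<ge> 1" "finite A" "A \<subseteq> {1..}"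
  shows "es n (P A x) = (if n \<in> A then es n x else 0)"
  using es_lincomb[OF assms] by (simp add: coord_proj_def)

lemma supp_P: "finite A \<Longrightarrow> A \<subseteq> {1..} \<Longrightarrow> supp es (P A x) = A \<inter> supp es x"
  by (auto simp: supp_def es_P split: if_splits)

lemma P_0: "A \<subseteq> {1..} \<Longrightarrow> P A 0 = 0"
  unfolding coord_proj_def by (intro sum.neutral) (auto simp: es_0)

lemma P_empty: "P {} x = 0"
  by (simp add: coord_proj_def)

lemma P_Un: "finite A \<Longrightarrow> finite B \<Longrightarrow> A \<inter> B = {} \<Longrightarrow> P (A \<union> B) x = P A x + P B x"
  unfolding coord_proj_def by (rule sum.union_disjoint)

lemma P_cong: "(\<And>n. n \<in> A \<Longrightarrow> es n x = es n y) \<Longrightarrow> P A x = P A y"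
  unfolding coord_proj_def by (intro sum.cong) auto

text \<open>
  The norm is convex in each coefficient, so moving the coefficients one at a time along the real line
  through \<open>0\<close> to one of the two points of modulus \<open>t\<close> can be done without decreasing it. Using
  only the two real multiples \<open>u\<close> and \<open>- u\<close> of the direction of a coefficient makes the argument
  independent of which scalar field is meant.
\<close>

lemma ex_sign_norm_le:
  assumes "finite A" "A \<subseteq> {1..}" "\<And>n. n \<in> A \<Longrightarrow> norm (c n) \<le> t"
  shows "\<exists>\<epsilon>. is_sign \<epsilon> \<and> norm (v + (\<Sum>n\<in>A. smul (c n) (e n))) \<le> norm (v + t *\<^sub>R ind \<epsilon> A)"
  using assms
proof (induction A arbitrary: v rule: finite_induct)
  case empty
  then show ?case by (intro exI[of _ "\<lambda>_. 1"]) (auto simp: is_sign_def signed_indicator_def)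
next
  case (insert n A)
  define u where "u = (if c n = 0 then 1 else c n /\<^sub>R norm (c n))"
  have u: "norm u = 1" "c n = norm (c n) *\<^sub>R u" by (auto simp: u_def)
  let ?S = "\<Sum>n\<in>A. smul (c n) (e n)"
  let ?g = "smul u (e n)"
  have "\<exists>\<sigma>. norm \<sigma> = 1 \<and> norm (v + ?S + smul (c n) (e n)) \<le> norm (v + ?S + t *\<^sub>R smul \<sigma> (e n))"
  proof -
    have "norm (v + ?S + norm (c n) *\<^sub>R ?g) \<le> norm (v + ?S + t *\<^sub>R smul u (e n)) \<or>
          norm (v + ?S + norm (c n) *\<^sub>R ?g) \<le> norm (v + ?S + t *\<^sub>R smul (- u) (e n))"
      using norm_segment_le_endpoint[of "norm (c n)" t "v + ?S" ?g] insert.prems(2)[of n]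
      by simp
    moreover have "smul (c n) (e n) = norm (c n) *\<^sub>R ?g"
      by (subst smul_scaleR[symmetric], subst u(2)[symmetric], rule refl)
    ultimately have "norm (v + ?S + smul (c n) (e n)) \<le> norm (v + ?S + t *\<^sub>R smul u (e n)) \<or>
        norm (v + ?S + smul (c n) (e n)) \<le> norm (v + ?S + t *\<^sub>R smul (- u) (e n))"
      by (simp only:)
    then show ?thesis 
    proof
      assume "norm (v + ?S + smul (c n) (e n)) \<le> norm (v + ?S + t *\<^sub>R smul u (e n))"
      with u(1) show ?thesis by blast
    next
      assume "norm (v + ?S + smul (c n) (e n)) \<le> norm (v + ?S + t *\<^sub>R smul (- u) (e n))"
      moreover have "norm (- u) = 1" using u(1) by simp
      ultimately show ?thesis by blast
    qed
  qed
  then obtain \<sigma> where \<sigma>: "norm \<sigma> = 1"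
    "norm (v + ?S + smul (c n) (e n)) \<le> norm (v + ?S + t *\<^sub>R smul \<sigma> (e n))" by blast
  obtain \<epsilon> where \<epsilon>: "is_sign \<epsilon>"
    "norm ((v + t *\<^sub>R smul \<sigma> (e n)) + ?S) \<le> norm ((v + t *\<^sub>R smul \<sigma> (e n)) + t *\<^sub>R ind \<epsilon> A)"
    using insert.IH[of "v + t *\<^sub>R smul \<sigma> (e n)"] insert.prems by auto
  have "ind (\<epsilon>(n := \<sigma>)) (insert n A) = smul \<sigma> (e n) + ind \<epsilon> A"
    using insert.hyps by (auto simp: signed_indicator_def intro!: sum.cong)
  then have "v + t *\<^sub>R ind (\<epsilon>(n := \<sigma>)) (insert n A) = (v + t *\<^sub>R smul \<sigma> (e n)) + t *\<^sub>R ind \<epsilon> A"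
    by (simp add: scaleR_add_right add.assoc)
  moreover have "v + (\<Sum>n\<in>insert n A. smul (c n) (e n)) = v + ?S + smul (c n) (e n)"
    using insert.hyps by (simp add: ac_simps)
  moreover have "v + ?S + t *\<^sub>R smul \<sigma> (e n) = (v + t *\<^sub>R smul \<sigma> (e n)) + ?S"
    by (simp only: ac_simps)
  ultimately have "norm (v + (\<Sum>n\<in>insert n A. smul (c n) (e n)))
      \<le> norm (v + t *\<^sub>R ind (\<epsilon>(n := \<sigma>)) (insert n A))"
    using order_trans[OF \<sigma>(2)] \<epsilon>(2) by (simp only:)
  moreover have "is_sign (\<epsilon>(n := \<sigma>))" using \<epsilon>(1) \<sigma>(1) by (auto simp: is_sign_def)
  ultimately show ?case by blast
qed

section \<open>Greedy sets and greedy operators\<close>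

lemma finite_supp_span:
  assumes "y \<in> span (e ` {1..})"
  shows "finite (supp es y)"
  using assms
proof (induction rule: span_induct_alt)
  case base
  have "supp es 0 = {}" by (auto simp: supp_def es_0)
  then show ?case by simp
next
  case (step c x y)
  then obtain k where k: "k \<ge> 1" "x = e k" by auto
  have "supp es (smul c x + y) \<subseteq> insert k (supp es y)"
    using k by (auto simp: supp_def es_add es_smul es_e split: if_splits)
  then show ?case using step.IH finite_subset by blast
qed

text \<open>
  The coordinates of a vector tend to \<open>0\<close>: this is clear on the span, and the functionals are uniformly
  bounded. It is what makes greedy sets of every order exist.
\<close>

lemma finite_large_coordinates:
  assumes "r > 0"
  shows "finite {n. n \<ge> 1 \<and> r \<le> norm (es n x)}"
proof -
  obtain b where b: "\<And>n x. n \<ge> 1 \<Longrightarrow> norm (es n x) \<le> b * norm x" "b > 0"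
    using es_uniformly_bounded by blast
  have "r / b > 0" using b assms by simp
  then obtain y where y: "y \<in> span (e ` {1..})" "dist y x < r / b"
    using closure_approachable[of x "span (e ` {1..})"] dense_span by auto
  have "{n. n \<ge> 1 \<and> r \<le> norm (es n x)} \<subseteq> supp es y"
  proof
    fix n assume n: "n \<in> {n. n \<ge> 1 \<and> r \<le> norm (es n x)}"
    have "norm (es n (x - y)) \<le> b * norm (x - y)"
      using n b(1) by simp
    also have "\<dots> < r"
      using y b by (simp add: dist_norm norm_minus_commute pos_less_divide_eq mult.commute)
    finally show "n \<in> supp es y" using n by (auto simp: supp_def es_diff)
  qed
  then show ?thesis using finite_supp_span[OF y(1)] finite_subset by blast
qed

lemma ex_largest_coordinate:
  assumes "finite C"
  shows "\<exists>n\<in>{1..} - C. \<forall>b\<in>{1..} - C. norm (es b x) \<le> norm (es n x)"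
proof (cases "\<exists>n\<in>{1..} - C. es n x \<noteq> 0")
  case True
  then obtain n where n: "n \<in> {1..} - C" "es n x \<noteq> 0" by blast
  let ?L = "{b. b \<ge> 1 \<and> norm (es n x) \<le> norm (es b x)} - C"
  have "finite ?L" using finite_large_coordinates[of "norm (es n x)" x] n by auto
  moreover have "n \<in> ?L" using n by auto
  ultimately obtain a where a: "a \<in> ?L" "\<And>b. b \<in> ?L \<Longrightarrow> norm (es b x) \<le> norm (es a x)"
    using ex_is_arg_min_if_finite[of ?L "\<lambda>b. - norm (es b x)"]
    by (fastforce simp: is_arg_min_linorder)
  have "norm (es b x) \<le> norm (es a x)" if "b \<in> {1..} - C" for b
    using that a(1) a(2)[of b] by (cases "norm (es n x) \<le> norm (es b x)") auto
  then show ?thesis using a by auto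
next
  case False
  have "infinite ({1..} - C)" using assms infinite_Ici[of "1::nat"] by simp
  then obtain n where "n \<in> {1..} - C" by (metis all_not_in_conv finite.emptyI)
  then show ?thesis using False by (intro bexI[of _ n]) auto
qed

lemma greedy_set_extend:
  assumes "greedy_set es k x C" "k \<le> j"
  shows "\<exists>B. greedy_set es j x B \<and> C \<subseteq> B"
  using assms(2,1)
proof (induction j rule: dec_induct)
  case base
  then show ?case by blast
next
  case (step j)
  then obtain B where B: "greedy_set es j x B" "C \<subseteq> B" by blast
  obtain n where n: "n \<in> {1..} - B" "\<And>b. b \<in> {1..} - B \<Longrightarrow> norm (es b x) \<le> norm (es n x)"
    using ex_largest_coordinate[of B x] B by (auto simp: greedy_set_def)
  have "greedy_set es (Suc j) x (insert n B)"
    using B n unfolding greedy_set_def by auto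
  then show ?case using B by blast
qed

lemma greedy_set_empty: "greedy_set es 0 x {}"
  by (simp add: greedy_set_def)

text \<open>
  The constants \<open>g_c\<close> and \<open>g_tilde\<close> are suprema over operators defined on the whole space, whereas
  the estimates concern one vector. Any nested pair of greedy sets of that vector can be completed to a
  nested choice of greedy sets at all other vectors.
\<close>

lemma ex_greedy_operators_through:
  assumes "greedy_set es k y C" "greedy_set es j y B" "C \<subseteq> B" "k \<le> j"
  shows "\<exists>G H. greedy_operator smul e es k G \<and> greedy_operator smul e es j H \<and>
           (\<forall>x. supp es (G x) \<subseteq> supp es (H x)) \<and> G y = P C y \<and> H y = P B y"
proof -
  have "\<exists>p. greedy_set es k x (fst p) \<and> greedy_set es j x (snd p) \<and> fst p \<subseteq> snd p \<and>
          (x = y \<longrightarrow> p = (C, B))" for x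
  proof (cases "x = y")
    case True
    then show ?thesis using assms by auto
  next
    case False
    obtain C' where C': "greedy_set es k x C'" using greedy_set_extend[OF greedy_set_empty] by blast
    obtain B' where "greedy_set es j x B'" "C' \<subseteq> B'" using greedy_set_extend[OF C' assms(4)] by blast
    then show ?thesis using C' False by (intro exI[of _ "(C', B')"]) auto
  qed
  then obtain p where p: "\<And>x. greedy_set es k x (fst (p x))" "\<And>x. greedy_set es j x (snd (p x))"
     "\<And>x. fst (p x) \<subseteq> snd (p x)" "p y = (C, B)"
    by metis
  let ?G = "\<lambda>x. P (fst (p x)) x" and ?H = "\<lambda>x. P (snd (p x)) x"
  have "supp es (?G x) \<subseteq> supp es (?H x)" for x
    using p(1)[of x] p(2)[of x] p(3)[of x] by (auto simp: greedy_set_def supp_P)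
  moreover have "greedy_operator smul e es k ?G" "greedy_operator smul e es j ?H"
    using p unfolding greedy_operator_def by blast+
  ultimately show ?thesis using p(4) by (intro exI[of _ ?G] exI[of _ ?H]) auto
qed

lemma greedy_operator_0:
  assumes "greedy_operator smul e es k G"
  shows "G 0 = 0"
proof -
  obtain A where "greedy_set es k 0 A" "G 0 = P A 0"
    using assms unfolding greedy_operator_def by blast
  then show ?thesis by (simp add: greedy_set_def P_0)
qed

text \<open>
  The last premise excludes \<open>a / 0 = \<infinity>\<close> with \<open>a > 0\<close>, where multiplying back would give
  \<open>\<infinity> * 0 = 0\<close>.
\<close>

lemma ennreal_le_of_ratio_le:
  assumes "ennreal a / ennreal b \<le> C" "0 \<le> a" "0 \<le> b" "b = 0 \<Longrightarrow> a = 0"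
  shows "ennreal a \<le> C * ennreal b"
proof (cases "b = 0")
  case False
  then have "ennreal a = ennreal a / ennreal b * ennreal b"
    using assms by (simp add: divide_ennreal flip: ennreal_mult)
  also have "\<dots> \<le> C * ennreal b" using assms by (intro mult_right_mono) auto
  finally show ?thesis .
qed (use assms in auto)

lemma norm_le_op_norm:
  assumes "T 0 = 0"
  shows "ennreal (norm (T y)) \<le> op_norm T * ennreal (norm y)"
proof (cases "y = 0")
  case False
  then show ?thesis
    unfolding op_norm_def by (intro ennreal_le_of_ratio_le SUP_upper) auto
qed (use assms in auto)

lemma norm_greedy_residual_le:
  assumes "greedy_set es k y C" "k \<le> m"
  shows "ennreal (norm (y - P C y)) \<le> g_c smul e es m * ennreal (norm y)"
proof -
  obtain G where G: "greedy_operator smul e es k G" "G y = P C y"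
    using ex_greedy_operators_through[OF assms(1,1)] by blast
  have "G 0 = 0" using G(1) by (rule greedy_operator_0)
  then have "ennreal (norm (y - G y)) \<le> op_norm (\<lambda>x. x - G x) * ennreal (norm y)"
    by (intro norm_le_op_norm) simp
  also have "\<dots> \<le> g_c smul e es m * ennreal (norm y)"
    unfolding g_c_def using G assms(2) by (intro mult_right_mono Sup_upper) auto
  finally show ?thesis using G by simp
qed

lemma norm_greedy_difference_le:
  assumes "greedy_set es k y C" "greedy_set es j y B" "C \<subseteq> B" "k < j" "j \<le> m"
  shows "ennreal (norm (P B y - P C y)) \<le> g_tilde smul e es m * ennreal (norm y)"
proof -
  obtain G H where GH: "greedy_operator smul e es k G" "greedy_operator smul e es j H"
     "\<forall>x. supp es (G x) \<subseteq> supp es (H x)" "G y = P C y" "H y = P B y"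
    using ex_greedy_operators_through[OF assms(1-3)] assms(4) by auto
  have "G 0 = 0" "H 0 = 0" using GH(1,2) by (auto intro: greedy_operator_0)
  then have "ennreal (norm (G y - H y)) \<le> op_norm (\<lambda>x. G x - H x) * ennreal (norm y)"
    by (intro norm_le_op_norm) simp
  also have "\<dots> \<le> g_tilde smul e es m * ennreal (norm y)"
    unfolding g_tilde_def using GH assms(4,5) by (intro mult_right_mono Sup_upper) auto
  finally show ?thesis using GH by (simp add: norm_minus_commute)
qed

text \<open>
  The value \<open>1\<close> at a vanishing coordinate makes this a sign even when a greedy set contains zero
  coordinates.
\<close>

definition coord_sign :: "'a \<Rightarrow> nat \<Rightarrow> 'f" where
  "coord_sign y n = (if es n y = 0 then 1 else es n y /\<^sub>R norm (es n y))"

lemma is_sign_coord_sign: "is_sign (coord_sign y)"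
  by (auto simp: is_sign_def coord_sign_def)

text \<open>
  The vector \<open>norm (es b0 y) *\<^sub>R ind (coord_sign y) B\<close> arises from \<open>P B y\<close> by shrinking the
  \<open>n\<close>-th coordinate by the factor \<open>norm (es b0 y) / norm (es n y)\<close>. These factors lie in \<open>[0, 1]\<close>,
  decrease as the coordinates grow, and equal \<open>1\<close> at \<open>b0\<close>, so the summation by parts applies. The set
  \<open>F\<close> it yields consists of the smallest coordinates in \<open>B\<close>, so the complement \<open>C = B - F\<close> is
  again greedy, and it is a proper subset as \<open>F\<close> is nonempty.
\<close>

lemma norm_truncation_le:
  assumes B: "greedy_set es j y B" and b0: "b0 \<in> B" "\<And>n. n \<in> B \<Longrightarrow> norm (es b0 y) \<le> norm (es n y)"
  shows "\<exists>C\<subset>B. greedy_set es (card C) y C \<and>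
           norm (v + norm (es b0 y) *\<^sub>R ind (coord_sign y) B) \<le> norm (v + (P B y - P C y))"
proof -
  let ?t = "norm (es b0 y)"
  \<comment> \<open>A vanishing coordinate forces \<open>?t = 0\<close>; the weight there must be the largest one, not \<open>?t / 0 = 0\<close>.\<close>
  define w where "w n = (if es n y = 0 then 1 else ?t / norm (es n y))" for n
  let ?f = "\<lambda>n. smul (es n y) (e n)"
  have fin: "finite B" using B by (simp add: greedy_set_def)
  have "\<exists>F\<subseteq>B. F \<noteq> {} \<and> (\<forall>a\<in>F. \<forall>b\<in>B - F. norm (es a y) \<le> norm (es b y)) \<and>
      norm (1 *\<^sub>R v + (\<Sum>n\<in>B. w n *\<^sub>R ?f n)) \<le> 1 * norm (v + sum ?f F)"
  proof (rule norm_weighted_sum_le_lower_set)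
    show "finite B" by fact
    show "B \<noteq> {}" using b0 by auto
    show "\<exists>n\<in>B. w n = 1" using b0(1) by (intro bexI[of _ b0]) (auto simp: w_def)
    show "0 \<le> w n \<and> w n \<le> 1" if "n \<in> B" for n
      using b0(2)[OF that] by (auto simp: w_def)
    show "w b \<le> w a" if "a \<in> B" "b \<in> B" "norm (es a y) \<le> norm (es b y)" for a b
      using b0(2)[OF that(1)] b0(2)[OF that(2)] that(3)
      by (auto simp: w_def intro: divide_left_mono)
  qed
  then obtain F where F: "F \<subseteq> B" "F \<noteq> {}" "\<forall>a\<in>F. \<forall>b\<in>B - F. norm (es a y) \<le> norm (es b y)"
    and le: "norm (v + (\<Sum>n\<in>B. w n *\<^sub>R ?f n)) \<le> norm (v + sum ?f F)" by auto
  have "w n *\<^sub>R ?f n = ?t *\<^sub>R smul (coord_sign y n) (e n)" if "n \<in> B" for n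
    using b0(2)[OF that]
    by (auto simp: w_def coord_sign_def divide_inverse simp flip: smul_scaleR)
  then have "(\<Sum>n\<in>B. w n *\<^sub>R ?f n) = ?t *\<^sub>R ind (coord_sign y) B"
    by (simp add: signed_indicator_def scaleR_sum_right)
  moreover have "sum ?f F = P B y - P (B - F) y"
    using sum.subset_diff[OF F(1) fin, of ?f] by (simp add: coord_proj_def)
  moreover have "greedy_set es (card (B - F)) y (B - F)"
    using B F by (auto simp: greedy_set_def)
  ultimately show ?thesis using le F by (intro exI[of _ "B - F"]) auto
qed

section \<open>The democracy constants in homogeneous form\<close>

text \<open>
  By biorthogonality the denominator of an admissible ratio vanishes only if \<open>B\<close>, and with it \<open>A\<close>, is
  empty; so the ratio bound can be multiplied out.
\<close>

lemma norm_ind_le_sc: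
  assumes "is_sign \<epsilon>" "is_sign \<delta>" "finite A" "A \<subseteq> nn ` {1..}" "finite B" "B \<subseteq> {1..}"
    "card A \<le> card B" "card B \<le> m" "\<forall>a\<in>A. a \<le> nn m" "set_less A (B \<inter> nn ` {1..})" "0 \<le> t"
  shows "ennreal (norm (t *\<^sub>R ind \<epsilon> A)) \<le> sc smul e nn m * ennreal (norm (t *\<^sub>R ind \<delta> B))"
proof -
  have "ennreal (norm (ind \<epsilon> A)) \<le> sc smul e nn m * ennreal (norm (ind \<delta> B))"
  proof (rule ennreal_le_of_ratio_le)
    show "ennreal (norm (ind \<epsilon> A)) / ennreal (norm (ind \<delta> B)) \<le> sc smul e nn m"
      unfolding sc_def by (rule Sup_upper) (use assms in blast)
    assume "norm (ind \<delta> B) = 0"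
    then have "b \<notin> B" for b
      using es_lincomb[of b B \<delta>] assms(2,5,6)
      by (force simp: signed_indicator_def is_sign_def es_0)
    then have "A = {}" using assms(3,7) by (metis card_eq_0_iff ex_in_conv le_zero_eq)
    then show "norm (ind \<epsilon> A) = 0" by (simp add: signed_indicator_def)
  qed auto
  then have "ennreal t * ennreal (norm (ind \<epsilon> A)) \<le> ennreal t * (sc smul e nn m * ennreal (norm (ind \<delta> B)))"
    by (intro mult_left_mono) auto
  then show ?thesis using assms(11) by (simp add: ennreal_mult mult_ac)
qed

lemma norm_add_ind_le_omega:
  assumes "is_sign \<epsilon>" "is_sign \<delta>" "finite A" "A \<subseteq> nn ` {1..}" "finite B" "B \<subseteq> {1..}"
    "card A \<le> card B" "card B \<le> m" "\<forall>a\<in>A. a \<le> nn m" "B \<inter> supp es z = {}"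
    "set_less A ((supp es z \<union> B) \<inter> nn ` {1..})" "sup_norm es z \<le> 1"
  shows "ennreal (norm (z + ind \<epsilon> A)) \<le> omega smul e es nn m * ennreal (norm (z + ind \<delta> B))"
proof (rule ennreal_le_of_ratio_le)
  show "ennreal (norm (z + ind \<epsilon> A)) / ennreal (norm (z + ind \<delta> B)) \<le> omega smul e es nn m"
    unfolding omega_def by (rule Sup_upper) (use assms in blast)
  assume 0: "norm (z + ind \<delta> B) = 0"
  have "b \<notin> B" for b
  proof
    assume b: "b \<in> B"
    then have "b \<ge> 1" "es b z = 0" using assms(6,10) by (auto simp: supp_def)
    then have "es b (z + ind \<delta> B) = \<delta> b"
      using es_lincomb[of b B \<delta>] assms(5,6) b by (simp add: es_add signed_indicator_def)
    then show False using 0 \<open>b \<ge> 1\<close> assms(2) by (auto simp: es_0 is_sign_def)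
  qed
  then have "B = {}" by blast
  moreover have "A = {}" using assms(3,7) \<open>B = {}\<close> by simp
  ultimately show "norm (z + ind \<epsilon> A) = 0" using 0 by (simp add: signed_indicator_def)
qed auto

text \<open>
  Homogeneity reduces a common height \<open>t > 0\<close> to the height \<open>1\<close> required by \<open>omega\<close>.
\<close>

lemma norm_add_scaled_ind_le_omega:
  assumes "is_sign \<epsilon>" "is_sign \<delta>" "finite A" "A \<subseteq> nn ` {1..}" "finite B" "B \<subseteq> {1..}"
    "card A \<le> card B" "card B \<le> m" "\<forall>a\<in>A. a \<le> nn m" "B \<inter> supp es z = {}"
    "set_less A ((supp es z \<union> B) \<inter> nn ` {1..})" "0 \<le> t" "\<And>n. n \<ge> 1 \<Longrightarrow> norm (es n z) \<le> t"
  shows "ennreal (norm (z + t *\<^sub>R ind \<epsilon> A)) \<le> omega smul e es nn m * ennreal (norm (z + t *\<^sub>R ind \<delta> B))"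
proof (cases "t = 0")
  case True
  \<comment> \<open>All coordinates of \<open>z\<close> vanish, but \<open>z\<close> need not. The pair of empty sets is admissible.\<close>
  have "supp es z = {}" "sup_norm es z \<le> 1"
    using assms(13) True by (auto simp: supp_def sup_norm_def intro!: SUP_least)
  then have "ennreal (norm (z + ind \<epsilon> {})) \<le> omega smul e es nn m * ennreal (norm (z + ind \<delta> {}))"
    using assms(1,2) by (intro norm_add_ind_le_omega) (auto simp: set_less_def)
  then show ?thesis using True by (simp add: signed_indicator_def)
next
  case False
  then have t: "t > 0" using assms(12) by simp
  let ?z = "z /\<^sub>R t"
  have "supp es ?z = supp es z" using t by (auto simp: supp_def es_scaleR)
  moreover have "sup_norm es ?z \<le> 1"
    unfolding sup_norm_def using assms(13) t by (auto simp: es_scaleR field_simps intro!: SUP_least)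
  ultimately have "ennreal (norm (?z + ind \<epsilon> A)) \<le> omega smul e es nn m * ennreal (norm (?z + ind \<delta> B))"
    using assms by (intro norm_add_ind_le_omega) auto
  then have "ennreal t * ennreal (norm (?z + ind \<epsilon> A))
      \<le> ennreal t * (omega smul e es nn m * ennreal (norm (?z + ind \<delta> B)))"
    by (intro mult_left_mono) auto
  moreover have "ennreal t * ennreal (norm (?z + u)) = ennreal (norm (z + t *\<^sub>R u))" for u
  proof -
    have "z + t *\<^sub>R u = t *\<^sub>R (?z + u)" using t by (simp add: scaleR_add_right)
    then show ?thesis using t by (simp add: ennreal_mult)
  qed
  moreover have "ennreal t * (omega smul e es nn m * u) = omega smul e es nn m * (ennreal t * u)" for u
    by (rule mult.left_commute)
  ultimately show ?thesis by (simp only:)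
qed

end

section \<open>A greedy sum against an initial segment of the subsequence\<close>

locale greedy_versus_initial = banach_basis smul e es
  for smul :: "'f::real_normed_field \<Rightarrow> 'a::banach \<Rightarrow> 'a" and e es +
  fixes nn :: "nat \<Rightarrow> nat" and m k :: nat and x :: 'a and A :: "nat set"
  assumes nn_mono: "strict_mono_on {1..} nn"
    and nn_pos: "\<forall>k\<ge>1. nn k \<ge> 1"
    and m_pos: "m \<ge> 1"
    and greedy_A: "greedy_set es m x A"
    and k_le: "k \<le> m"
begin

definition D where "D = nn ` {1..k}"
definition y where "y = x - P D x"
abbreviation B where "B \<equiv> A - D"
abbreviation H where "H \<equiv> D - A"

lemma finite_D: "finite D" and D_pos: "D \<subseteq> {1..}"
  using nn_pos by (auto simp: D_def)

lemma inj_nn: "inj_on nn {1..k}"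
  using nn_mono by (rule strict_mono_on_imp_inj_on[THEN inj_on_subset]) auto

lemma card_D: "card D = k"
  unfolding D_def card_image[OF inj_nn] by simp

lemma y_eq: "y = x - partial_sum smul e es nn k x"
  unfolding y_def D_def coord_proj_def partial_sum_def sum.reindex[OF inj_nn] by simp

lemma finite_A: "finite A" and A_pos: "A \<subseteq> {1..}" and card_A: "card A = m"
  and A_dominates: "a \<in> A \<Longrightarrow> b \<in> {1..} - A \<Longrightarrow> norm (es b x) \<le> norm (es a x)"
  using greedy_A by (auto simp: greedy_set_def)

lemma card_H_le: "card H \<le> card B"
  using finite_A finite_D card_D card_A k_le by (intro card_le_sym_Diff) auto

lemma card_B_le: "card B \<le> m"
  using card_mono[of A B] finite_A card_A by auto

lemma es_y: "n \<ge> 1 \<Longrightarrow> es n y = (if n \<in> D then 0 else es n x)"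
  by (simp add: y_def es_diff es_P[OF _ finite_D D_pos])

lemma greedy_B: "greedy_set es (card B) y B"
  unfolding greedy_set_def using finite_A A_pos A_dominates by (force simp: es_y)

lemma P_B: "P B x = P B y"
  using A_pos by (intro P_cong) (auto simp: es_y subset_iff)

text \<open>
  Both \<open>x - P A x\<close> and \<open>y - P B y\<close> are obtained from \<open>x\<close> by removing coordinates: those in \<open>A\<close> and
  those in \<open>A \<union> D\<close>, respectively.
\<close>

lemma residual_eq: "x - P A x = (y - P B y) + P H x"
proof -
  have "P A x = P B x + P (A \<inter> D) x" "P D x = P H x + P (A \<inter> D) x"
  proof -
    have "B \<union> (A \<inter> D) = A" "H \<union> (A \<inter> D) = D" by auto
    moreover have "P (B \<union> (A \<inter> D)) x = P B x + P (A \<inter> D) x" "P (H \<union> (A \<inter> D)) x = P H x + P (A \<inter> D) x"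
      using finite_A finite_D by (auto intro!: P_Un)
    ultimately show "P A x = P B x + P (A \<inter> D) x" "P D x = P H x + P (A \<inter> D) x" by simp_all
  qed
  then have "x - P A x = ((x - P D x) - P B x) + P H x" by simp
  then show ?thesis by (simp only: y_def[symmetric] P_B)
qed

text \<open>
  The greedy choice of \<open>A\<close> prefers \<open>b\<close> to \<open>h\<close>, and passing from \<open>x\<close> to \<open>y\<close> leaves the
  coordinate at \<open>b\<close> unchanged.
\<close>

lemma H_le_B: "h \<in> H \<Longrightarrow> b \<in> B \<Longrightarrow> norm (es h x) \<le> norm (es b y)"
  using A_dominates[of b h] A_pos D_pos by (auto simp: es_y subset_iff)

lemma es_z:
  assumes "n \<ge> 1"
  shows "es n (y - P B y) = (if n \<in> A \<union> D then 0 else es n x)"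
  using assms finite_A A_pos by (simp add: es_diff es_P es_y Diff_subset subset_trans[OF Diff_subset])

lemma H_in_nn: "H \<subseteq> nn ` {1..}" and H_le_nn_m: "\<forall>h\<in>H. h \<le> nn m"
proof -
  show "H \<subseteq> nn ` {1..}" by (auto simp: D_def)
  have "nn i \<le> nn m" if "1 \<le> i" "i \<le> k" for i
    using that k_le strict_mono_onD[OF nn_mono, of i m] by (cases "i = m") auto
  then show "\<forall>h\<in>H. h \<le> nn m" by (auto simp: D_def)
qed

text \<open>
  \<open>D\<close> is an initial segment of the subsequence, so every term outside \<open>D\<close> exceeds all of \<open>D\<close>. This
  supplies the order condition in \<open>sc\<close> and \<open>omega\<close>.
\<close>

lemma H_less:
  assumes "S \<inter> D = {}"
  shows "set_less H (S \<inter> nn ` {1..})"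
  unfolding set_less_def
proof (intro ballI)
  fix h s assume "h \<in> H" "s \<in> S \<inter> nn ` {1..}"
  then obtain i j where ij: "h = nn i" "1 \<le> i" "i \<le> k" "s = nn j" "1 \<le> j" "s \<in> S"
    by (auto simp: D_def)
  then have "k < j" using assms by (force simp: D_def)
  then show "h < s" using ij strict_mono_onD[OF nn_mono, of i j] by auto
qed

lemma finite_H: "finite H" and H_pos: "H \<subseteq> {1..}" and finite_B: "finite B" and B_pos: "B \<subseteq> {1..}"
  using finite_A finite_D A_pos D_pos by auto

lemma H_empty_if_B_empty:
  assumes "B = {}"
  shows "H = {}"
proof -
  have "card H \<le> 0" using card_H_le unfolding assms by simp
  then show ?thesis using finite_H by (simp only: le_zero_eq card_0_eq)
qed

lemma ex_smallest_in_B: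
  assumes "B \<noteq> {}"
  obtains b0 where "b0 \<in> B" "\<And>n. n \<in> B \<Longrightarrow> norm (es b0 y) \<le> norm (es n y)"
  using ex_is_arg_min_if_finite[OF finite_B assms, of "\<lambda>n. norm (es n y)"]
  by (auto simp: is_arg_min_linorder)

lemma kappa_bound: "ennreal (norm (x - P A x)) \<le> (1 + 2 * kappa e es * of_nat m) * ennreal (norm y)"
proof -
  \<comment> \<open>The uniform bounds on the basis make \<open>kappa\<close> finite, so the estimate is one between real numbers.\<close>
  obtain b where b: "\<forall>n\<ge>1. norm (e n) \<le> b \<and> onorm (es n) \<le> b"
    using basis unfolding basis_of_def by auto
  have "norm (e i) * onorm (es j) \<le> b * b" if "i \<ge> 1" "j \<ge> 1" for i j
    using b that by (intro mult_mono) (auto intro: onorm_pos_le[OF es_bounded_linear] order_trans[OF norm_ge_zero])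
  then have "kappa e es \<le> ennreal (b * b)"
    unfolding kappa_def by (intro SUP_least ennreal_leI) auto
  then have "kappa e es < top" using ennreal_less_top le_less_trans by blast
  then obtain K where K: "kappa e es = ennreal K" "K \<ge> 0" by (cases "kappa e es") auto
  have K1: "norm (e i) * norm (es j y) \<le> K * norm y" if "i \<ge> 1" "j \<ge> 1" for i j
  proof -
    have "ennreal (norm (e i) * onorm (es j)) \<le> kappa e es"
      unfolding kappa_def using that by (auto intro: SUP_upper2)
    then have "norm (e i) * onorm (es j) \<le> K" using K by simp
    then have "norm (e i) * onorm (es j) * norm y \<le> K * norm y" by (intro mult_right_mono) auto
    moreover have "norm (e i) * norm (es j y) \<le> norm (e i) * (onorm (es j) * norm y)"
      using es_bound[OF that(2)] by (intro mult_left_mono) auto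
    ultimately show ?thesis by (simp add: mult_ac)
  qed
  have PB: "norm (P B y) \<le> card B * (K * norm y)"
    unfolding coord_proj_def
    by (rule sum_norm_bound) (use K1 B_pos in \<open>auto simp: norm_scale mult.commute\<close>)
  have "norm (P H x) \<le> card H * (K * norm y)"
  proof (cases "B = {}")
    case True
    show ?thesis unfolding H_empty_if_B_empty[OF True] by (simp add: P_empty)
  next
    case False
    then obtain b where b: "b \<in> B" by blast
    have "norm (smul (es h x) (e h)) \<le> K * norm y" if "h \<in> H" for h
    proof -
      have "norm (smul (es h x) (e h)) \<le> norm (e h) * norm (es b y)"
        using mult_left_mono[OF H_le_B[OF that b], of "norm (e h)"] by (simp add: norm_scale mult.commute)
      also have "\<dots> \<le> K * norm y" using K1[of h b] that b H_pos B_pos by auto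
      finally show ?thesis .
    qed
    then show ?thesis unfolding coord_proj_def by (rule sum_norm_bound)
  qed
  then have "norm (x - P A x) \<le> norm y + card B * (K * norm y) + card H * (K * norm y)"
    unfolding residual_eq using PB norm_triangle_ineq[of "y - P B y" "P H x"] norm_triangle_ineq4[of y "P B y"]
    by linarith
  moreover have "card B * (K * norm y) \<le> m * (K * norm y)" "card H * (K * norm y) \<le> m * (K * norm y)"
    using card_B_le card_H_le K by (auto intro!: mult_right_mono)
  ultimately have "norm (x - P A x) \<le> (1 + 2 * K * m) * norm y"
    by (simp add: algebra_simps)
  then have "ennreal (norm (x - P A x)) \<le> ennreal ((1 + 2 * K * m) * norm y)"
    by (rule ennreal_leI)
  also have "\<dots> = ennreal (1 + 2 * K * m) * ennreal (norm y)"
    using K by (intro ennreal_mult) auto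
  also have "ennreal (1 + 2 * K * m) = 1 + 2 * kappa e es * of_nat m"
    using K by (simp add: ennreal_plus ennreal_mult flip: ennreal_of_nat_eq_real_of_nat ennreal_numeral)
  finally show ?thesis .
qed

lemma sc_bound:
  "ennreal (norm (x - P A x))
    \<le> (g_c smul e es m + g_tilde smul e es m * sc smul e nn m) * ennreal (norm y)"
proof -
  have H: "ennreal (norm (P H x)) \<le> g_tilde smul e es m * sc smul e nn m * ennreal (norm y)"
  proof (cases "B = {}")
    case True
    show ?thesis unfolding H_empty_if_B_empty[OF True] by (simp add: P_empty)
  next
    case False
    then obtain b0 where b0: "b0 \<in> B" "\<And>n. n \<in> B \<Longrightarrow> norm (es b0 y) \<le> norm (es n y)"
      using ex_smallest_in_B by blast
    let ?t = "norm (es b0 y)"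
    obtain \<epsilon> where \<epsilon>: "is_sign \<epsilon>" "norm (P H x) \<le> norm (?t *\<^sub>R ind \<epsilon> H)"
      using ex_sign_norm_le[of H "\<lambda>n. es n x" ?t 0] finite_H H_pos H_le_B[OF _ b0(1)]
      by (auto simp: coord_proj_def)
    obtain C where C: "C \<subset> B" "greedy_set es (card C) y C"
        "norm (?t *\<^sub>R ind (coord_sign y) B) \<le> norm (P B y - P C y)"
      using norm_truncation_le[OF greedy_B b0, of 0] by auto
    have "ennreal (norm (P H x)) \<le> ennreal (norm (?t *\<^sub>R ind \<epsilon> H))"
      using \<epsilon> by (intro ennreal_leI)
    also have "\<dots> \<le> sc smul e nn m * ennreal (norm (?t *\<^sub>R ind (coord_sign y) B))"
    proof (rule norm_ind_le_sc)
      show "set_less H (B \<inter> nn ` {1..})" by (intro H_less) blast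
    qed (use \<epsilon> is_sign_coord_sign finite_H finite_B H_in_nn B_pos card_H_le card_B_le H_le_nn_m in auto)
    also have "\<dots> \<le> sc smul e nn m * ennreal (norm (P B y - P C y))"
      using C by (intro mult_left_mono ennreal_leI) auto
    also have "\<dots> \<le> sc smul e nn m * (g_tilde smul e es m * ennreal (norm y))"
      using C greedy_B card_B_le psubset_card_mono[OF finite_B C(1)]
      by (intro mult_left_mono norm_greedy_difference_le) auto
    finally show ?thesis by (simp add: mult_ac)
  qed
  have "ennreal (norm (x - P A x)) \<le> ennreal (norm (y - P B y)) + ennreal (norm (P H x))"
    unfolding residual_eq by (simp add: norm_triangle_ineq flip: ennreal_plus)
  also have "\<dots> \<le> g_c smul e es m * ennreal (norm y) + g_tilde smul e es m * sc smul e nn m * ennreal (norm y)"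
    using greedy_B card_B_le H by (intro add_mono norm_greedy_residual_le)
  finally show ?thesis by (simp add: distrib_right)
qed

lemma omega_bound:
  "ennreal (norm (x - P A x)) \<le> g_c smul e es (m - 1) * omega smul e es nn m * ennreal (norm y)"
proof -
  let ?z = "y - P B y"
  \<comment> \<open>A height \<open>t\<close> that dominates the coordinates of \<open>?z\<close> and those of \<open>x\<close> on \<open>H\<close>. It is the smallest
    coordinate of \<open>y\<close> on \<open>B\<close>; if \<open>B\<close> is empty then so is \<open>H\<close>, and any bound for \<open>?z\<close> will do.\<close>
  have "\<exists>t\<ge>0. (\<forall>n\<ge>1. norm (es n ?z) \<le> t) \<and> (\<forall>h\<in>H. norm (es h x) \<le> t) \<and>
     ennreal (norm (?z + t *\<^sub>R ind (coord_sign y) B)) \<le> g_c smul e es (m - 1) * ennreal (norm y)"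
  proof (cases "B = {}")
    case True
    have "ind (coord_sign y) B = 0" unfolding True by (simp add: signed_indicator_def)
    moreover have z: "?z = y" unfolding True P_empty by simp
    ultimately have eq: "?z + t *\<^sub>R ind (coord_sign y) B = y" for t by simp
    obtain b where b: "b > 0" "\<forall>n\<ge>1. norm (es n ?z) \<le> b * norm ?z"
      using es_uniformly_bounded by blast
    have "ennreal (norm y) \<le> g_c smul e es (m - 1) * ennreal (norm y)"
      using norm_greedy_residual_le[OF greedy_set_empty, of "m - 1" y] by (simp add: P_empty)
    then have "ennreal (norm (?z + (b * norm ?z) *\<^sub>R ind (coord_sign y) B)) \<le> g_c smul e es (m - 1) * ennreal (norm y)"
      by (subst eq)
    moreover have "\<forall>h\<in>H. norm (es h x) \<le> b * norm ?z" unfolding H_empty_if_B_empty[OF True] by simp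
    moreover have "0 \<le> b * norm ?z" using b(1) by simp
    ultimately show ?thesis using b(2) by (intro exI[of _ "b * norm ?z"] conjI)
  next
    case False
    then obtain b0 where b0: "b0 \<in> B" "\<And>n. n \<in> B \<Longrightarrow> norm (es b0 y) \<le> norm (es n y)"
      using ex_smallest_in_B by blast
    let ?t = "norm (es b0 y)"
    obtain C where C: "C \<subset> B" "greedy_set es (card C) y C"
        "norm (?z + ?t *\<^sub>R ind (coord_sign y) B) \<le> norm (?z + (P B y - P C y))"
      using norm_truncation_le[OF greedy_B b0, of ?z] by auto
    have "card C \<le> m - 1" using psubset_card_mono[OF finite_B C(1)] card_B_le by linarith
    then have "ennreal (norm (y - P C y)) \<le> g_c smul e es (m - 1) * ennreal (norm y)"
      using C by (intro norm_greedy_residual_le)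
    moreover have "?z + (P B y - P C y) = y - P C y" by simp
    then have "norm (?z + ?t *\<^sub>R ind (coord_sign y) B) \<le> norm (y - P C y)"
      using C(3) by (simp only:)
    then have "ennreal (norm (?z + ?t *\<^sub>R ind (coord_sign y) B)) \<le> ennreal (norm (y - P C y))"
      by (rule ennreal_leI)
    ultimately have "ennreal (norm (?z + ?t *\<^sub>R ind (coord_sign y) B)) \<le> g_c smul e es (m - 1) * ennreal (norm y)"
      by (rule order_trans[rotated])
    moreover have "norm (es n ?z) \<le> ?t" if "n \<ge> 1" for n
      using that b0(1) A_dominates[of b0 n] A_pos by (auto simp: es_z es_y subset_iff)
    ultimately show ?thesis using H_le_B[OF _ b0(1)] by (intro exI[of _ ?t]) auto
  qed
  then obtain t where t: "t \<ge> 0" "\<And>n. n \<ge> 1 \<Longrightarrow> norm (es n ?z) \<le> t" "\<And>h. h \<in> H \<Longrightarrow> norm (es h x) \<le> t"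
    and g: "ennreal (norm (?z + t *\<^sub>R ind (coord_sign y) B)) \<le> g_c smul e es (m - 1) * ennreal (norm y)"
    by blast
  have supp_z: "supp es ?z \<inter> (A \<union> D) = {}" by (auto simp: supp_def es_z)
  obtain \<epsilon> where \<epsilon>: "is_sign \<epsilon>" "norm (?z + P H x) \<le> norm (?z + t *\<^sub>R ind \<epsilon> H)"
    using ex_sign_norm_le[of H "\<lambda>n. es n x" t ?z] finite_H H_pos t(3) by (auto simp: coord_proj_def)
  have "ennreal (norm (x - P A x)) \<le> ennreal (norm (?z + t *\<^sub>R ind \<epsilon> H))"
    unfolding residual_eq using \<epsilon> by (intro ennreal_leI)
  also have "\<dots> \<le> omega smul e es nn m * ennreal (norm (?z + t *\<^sub>R ind (coord_sign y) B))"
  proof (rule norm_add_scaled_ind_le_omega)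
    show "B \<inter> supp es ?z = {}" using supp_z by blast
    show "set_less H ((supp es ?z \<union> B) \<inter> nn ` {1..})" using supp_z by (intro H_less) blast
  qed (use \<epsilon> is_sign_coord_sign finite_H finite_B H_in_nn B_pos card_H_le card_B_le H_le_nn_m t in auto)
  also have "\<dots> \<le> omega smul e es nn m * (g_c smul e es (m - 1) * ennreal (norm y))"
    using g by (intro mult_left_mono) auto
  finally show ?thesis by (simp add: mult_ac)
qed

end

section \<open>Bounds for the Lebesgue-type constant\<close>

text \<open>
  The minimum defining \<open>sigma_hat\<close> is attained by some partial sum, so a bound against every partial
  sum is enough.
\<close>

lemma L_hat_le:
  assumes "\<And>x A k. greedy_set es m x A \<Longrightarrow> k \<le> m \<Longrightarrow>
     ennreal (norm (x - coord_proj smul e es A x)) \<le> C * ennreal (norm (x - partial_sum smul e es nn k x))"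
  shows "L_hat smul e es nn m \<le> C"
proof -
  have "gamma_greedy smul e es m x \<le> C * ennreal (sigma_hat smul e es nn m x)" for x
  proof -
    have "sigma_hat smul e es nn m x \<in> (\<lambda>k. norm (x - partial_sum smul e es nn k x)) ` {0..m}"
      unfolding sigma_hat_def by (rule Min_in) auto
    then obtain k where "k \<le> m" "sigma_hat smul e es nn m x = norm (x - partial_sum smul e es nn k x)"
      by auto
    then show ?thesis unfolding gamma_greedy_def using assms by (auto intro!: SUP_least)
  qed
  then show ?thesis unfolding L_hat_def by (intro Inf_lower) auto
qed

theorem theorem4p2:
  fixes smul :: "'f::real_normed_field \<Rightarrow> 'a::banach \<Rightarrow> 'a"
    and e :: "nat \<Rightarrow> 'a" and es :: "nat \<Rightarrow> 'a \<Rightarrow> 'f"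
    and nn :: "nat \<Rightarrow> nat" and m :: nat
  assumes "separable_banach_space smul"
    and "basis_of smul e es"
    and "strict_mono_on {1..} nn"
    and "\<forall>k\<ge>1. nn k \<ge> 1"
    and "m \<ge> 1"
  shows "L_hat smul e es nn m \<le> 1 + 2 * kappa e es * of_nat m \<and>
         L_hat smul e es nn m \<le> g_c smul e es m + g_tilde smul e es m * sc smul e nn m \<and>
         L_hat smul e es nn m \<le> g_c smul e es (m - 1) * omega smul e es nn m"
proof -
  have bounds:
    "ennreal (norm (x - coord_proj smul e es A x))
       \<le> (1 + 2 * kappa e es * of_nat m) * ennreal (norm (x - partial_sum smul e es nn k x))"
    "ennreal (norm (x - coord_proj smul e es A x))
       \<le> (g_c smul e es m + g_tilde smul e es m * sc smul e nn m)
           * ennreal (norm (x - partial_sum smul e es nn k x))"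
    "ennreal (norm (x - coord_proj smul e es A x))
       \<le> g_c smul e es (m - 1) * omega smul e es nn m * ennreal (norm (x - partial_sum smul e es nn k x))"
    if "greedy_set es m x A" "k \<le> m" for x A k
  proof -
    interpret greedy_versus_initial smul e es nn m k x A
      using assms that
      by (intro greedy_versus_initial.intro banach_basis.intro banach_basis_axioms.intro
          greedy_versus_initial_axioms.intro)
    show "ennreal (norm (x - coord_proj smul e es A x))
       \<le> (1 + 2 * kappa e es * of_nat m) * ennreal (norm (x - partial_sum smul e es nn k x))"
      using kappa_bound unfolding y_eq .
    show "ennreal (norm (x - coord_proj smul e es A x))
       \<le> (g_c smul e es m + g_tilde smul e es m * sc smul e nn m)
           * ennreal (norm (x - partial_sum smul e es nn k x))"
      using sc_bound unfolding y_eq .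
    show "ennreal (norm (x - coord_proj smul e es A x))
       \<le> g_c smul e es (m - 1) * omega smul e es nn m * ennreal (norm (x - partial_sum smul e es nn k x))"
      using omega_bound unfolding y_eq .
  qed
  from bounds show ?thesis
    by (intro conjI L_hat_le)
qed

end
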